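(* Consider a causal model on a causal structure $\mathcal G$, and let $X,Y,Z$ be pairwise disjoint sets of observed nodes with $X,Y$ non-empty. If the affects relation $X\vDash Y\mid\mathrm{do}(Z)$ holds and is Clus$_1$, then each $e_X\in X$ is a cause of at least one element $e_Y\in Y$, i.e. there is a directed path from $e_X$ to $e_Y$ in $\mathcal G$.
   Context: **Causal model.** A causal structure is a directed graph $\mathcal G$ (cycles allowed) whose nodes are observed or unobserved; the finitely many observed nodes are random variables. For sets of nodes, $AB:=A\cup B$. A path between two nodes (ignoring edge directions) is blocked by a set $C$ if it contains a chain $A\to V\to B$ or fork $A\leftarrow V\to B$ with $V\in C$, or a collider $A\to V\leftarrow B$ with neither $V$ nor any descendant of $V$ in $C$. For disjoint $A,B,C$, $(A\perp^dB\mid C)_{\mathcal G}$ means every path from an element of $A$ to an element of $B$ is blocked by $C$. A distribution $P$ over the observed nodes has the d-separation property relative to $\mathcal G$ if $(A\perp^dB|C)_{\mathcal G}$ implies $P(AB|C)=P(A|C)P(B|C)$ for all disjoint sets $A,B,C$ of observed nodes. For a set $X$ of observed nodes, $\mathcal G_{\mathrm{do}(X)}$ is $\mathcal G$ with all edges into nodes of $X$ removed ($\mathcal G_{\mathrm{do}(\emptyset)}=\mathcal G$). A causal model consists of $\mathcal G$, and for every set $X$ of observed nodes a distribution $P_{\mathcal G_{\mathrm{do}(X)}}$ of the observed nodes with the d-separation property relative to $\mathcal G_{\mathrm{do}(X)}$, such that if $X$ consists of nodes exogenous in $\mathcal G$ and is disjoint from $Y$, then $P_{\mathcal G_{\mathrm{do}(Y)}}(R|XY)=P_{\mathcal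 G_{\mathrm{do}(XY)}}(R|XY)$ for $R$ the remaining observed nodes. Conditional distributions given values of intervened nodes are taken as specified for all such values. Standing fact of the framework (third rule of do-calculus): for disjoint sets of observed nodes, $P_{\mathcal G_{\mathrm{do}(XZ)}}(Y|XZ)=P_{\mathcal G_{\mathrm{do}(X)}}(Y|X)$ whenever $(Y\perp^dZ\mid X)_{\mathcal G_{\mathrm{do}(XZ)}}$. **Affects relations.** For pairwise disjoint $X,Y,Z$ with $X,Y$ non-empty, $X\vDash Y\mid\mathrm{do}(Z)$ holds iff there are values $x,z$ with $P_{\mathcal G_{\mathrm{do}(XZ)}}(Y|X=x,Z=z)\ne P_{\mathcal G_{\mathrm{do}(Z)}}(Y|Z=z)$. **Clustering.** $X\vDash Y\mid\mathrm{do}(Z)$ is Clus$_1$ (clustered in the first argument) if $|X|\ge2$ and no (non-empty) $s_X\subsetneq X$ satisfies $s_X\vDash Y\mid\mathrm{do}(Z)$. *)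

theory Defs
  imports "HOL-Probability.Probability"
begin

section \<open>Directed graphs and d-separation\<close>

text \<open>A causal structure has a set of nodes \<open>V\<close>, a set of edges \<open>E\<close> (a pair \<open>(u, v)\<close> is an edge
  from \<open>u\<close> to \<open>v\<close>; cycles are allowed) and a finite set \<open>Obs\<close> of observed nodes.  Nodes in
  \<open>V - Obs\<close> are unobserved.\<close>

locale causal_structure =
  fixes V :: "'v set" and E :: "'v rel" and Obs :: "'v set"
  assumes edges_subset: "E \<subseteq> V \<times> V"
    and obs_subset: "Obs \<subseteq> V"
    and finite_obs: "finite Obs"

definition do_graph :: "'v rel \<Rightarrow> 'v set \<Rightarrow> 'v rel" where
  "do_graph E X = {(u, v) \<in> E. v \<notin> X}"

definition exogenous :: "'v rel \<Rightarrow> 'v \<Rightarrow> bool" where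
  "exogenous E v \<longleftrightarrow> (\<nexists>u. (u, v) \<in> E)"

text \<open>A path ignoring edge directions is a list \<open>p\<close> of pairwise distinct nodes together with a list
  \<open>d\<close> recording the direction of the edge used between \<open>p ! i\<close> and \<open>p ! (i + 1)\<close>.  The directions
  are needed because in a cyclic graph both edges between two nodes may be present, and the choice
  of the edge determines which nodes of the path are colliders.\<close>

datatype direction = Forward | Backward

definition is_path :: "'v rel \<Rightarrow> 'v list \<Rightarrow> direction list \<Rightarrow> bool" where
  "is_path E p d \<longleftrightarrow> length p = Suc (length d) \<and> distinct p \<and>
     (\<forall>i < length d. case d ! i of
          Forward \<Rightarrow> (p ! i, p ! Suc i) \<in> E
        | Backward \<Rightarrow> (p ! Suc i, p ! i) \<in> E)"

definition collider_at :: "direction list \<Rightarrow> nat \<Rightarrow> bool" where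
  "collider_at d i \<longleftrightarrow> d ! (i - 1) = Forward \<and> d ! i = Backward"

text \<open>The indices of the inner nodes of the path are \<open>0 < i < length d\<close>.  An inner node which is not
  a collider is the middle node of a chain or of a fork.\<close>

definition path_blocked :: "'v rel \<Rightarrow> 'v list \<Rightarrow> direction list \<Rightarrow> 'v set \<Rightarrow> bool" where
  "path_blocked E p d C \<longleftrightarrow>
     (\<exists>i. 0 < i \<and> i < length d \<and>
        (\<not> collider_at d i \<and> p ! i \<in> C \<or>
         collider_at d i \<and> p ! i \<notin> C \<and> (\<forall>w. (p ! i, w) \<in> E\<^sup>+ \<longrightarrow> w \<notin> C)))"

definition d_separated :: "'v rel \<Rightarrow> 'v set \<Rightarrow> 'v set \<Rightarrow> 'v set \<Rightarrow> bool" where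
  "d_separated E A B C \<longleftrightarrow>
     (\<forall>p d. is_path E p d \<and> hd p \<in> A \<and> last p \<in> B \<longrightarrow> path_blocked E p d C)"

section \<open>Distributions of the observed nodes\<close>

text \<open>The random variable at the node \<open>v\<close> takes values in the measurable space \<open>M v\<close> (only the
  underlying set and sigma-algebra of \<open>M v\<close> matter, and for a discrete random variable \<open>M v\<close> is a
  \<open>count_space\<close>).  A joint value of the nodes in \<open>S\<close> is an element of \<open>space (PiM S M)\<close>, and a
  distribution of the observed nodes is a probability measure on \<open>PiM Obs M\<close>.

  \<open>value_algebra M Q C\<close> is the sigma-algebra generated by the nodes in \<open>C\<close>.\<close>

definition value_algebra ::
  "('v \<Rightarrow> 'a measure) \<Rightarrow> ('v \<Rightarrow> 'a) measure \<Rightarrow> 'v set \<Rightarrow> ('v \<Rightarrow> 'a) measure" where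
  "value_algebra M Q C = vimage_algebra (space Q) (\<lambda>\<omega>. restrict \<omega> C) (PiM C M)"

definition value_event ::
  "('v \<Rightarrow> 'a) measure \<Rightarrow> 'v set \<Rightarrow> ('v \<Rightarrow> 'a) set \<Rightarrow> ('v \<Rightarrow> 'a) set" where
  "value_event Q A a = {\<omega> \<in> space Q. restrict \<omega> A \<in> a}"

text \<open>This is \<open>P(AB|C) = P(A|C) P(B|C)\<close>, stated for all events of \<open>A\<close> and \<open>B\<close>.\<close>

definition cond_indep ::
  "('v \<Rightarrow> 'a measure) \<Rightarrow> ('v \<Rightarrow> 'a) measure \<Rightarrow> 'v set \<Rightarrow> 'v set \<Rightarrow> 'v set \<Rightarrow> bool" where
  "cond_indep M Q A B C \<longleftrightarrow>
     (\<forall>a \<in> sets (PiM A M). \<forall>b \<in> sets (PiM B M). AE \<omega> in Q.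
        real_cond_exp Q (value_algebra M Q C)
            (indicator (value_event Q A a \<inter> value_event Q B b)) \<omega>
        = real_cond_exp Q (value_algebra M Q C) (indicator (value_event Q A a)) \<omega>
          * real_cond_exp Q (value_algebra M Q C) (indicator (value_event Q B b)) \<omega>)"

text \<open>\<open>\<kappa>\<close> is a conditional distribution of the observed nodes given the values of the nodes in \<open>X\<close>:
  \<open>\<kappa> x\<close> is a probability measure under which the nodes in \<open>X\<close> have the value \<open>x\<close>, and averaging
  \<open>\<kappa> x\<close> over the distribution of \<open>X\<close> yields \<open>Q\<close>.  Values \<open>x\<close> of probability 0 are included.\<close>

definition cond_distribution ::
  "'v set \<Rightarrow> ('v \<Rightarrow> 'a measure) \<Rightarrow> ('v \<Rightarrow> 'a) measure \<Rightarrow> 'v set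
    \<Rightarrow> (('v \<Rightarrow> 'a) \<Rightarrow> ('v \<Rightarrow> 'a) measure) \<Rightarrow> bool" where
  "cond_distribution Obs M Q X \<kappa> \<longleftrightarrow>
     \<kappa> \<in> PiM X M \<rightarrow>\<^sub>M prob_algebra (PiM Obs M) \<and>
     (\<forall>x \<in> space (PiM X M).
        distr (\<kappa> x) (PiM X M) (\<lambda>\<omega>. restrict \<omega> X) = return (PiM X M) x) \<and>
     Q = distr Q (PiM X M) (\<lambda>\<omega>. restrict \<omega> X) \<bind> \<kappa>"

text \<open>\<open>P(Y|X = x)\<close>, for a conditional distribution \<open>\<kappa>\<close> given \<open>X\<close>.\<close>

definition cond_marginal ::
  "('v \<Rightarrow> 'a measure) \<Rightarrow> (('v \<Rightarrow> 'a) \<Rightarrow> ('v \<Rightarrow> 'a) measure) \<Rightarrow> 'v set \<Rightarrow> ('v \<Rightarrow> 'a)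
    \<Rightarrow> ('v \<Rightarrow> 'a) measure" where
  "cond_marginal M \<kappa> Y x = distr (\<kappa> x) (PiM Y M) (\<lambda>\<omega>. restrict \<omega> Y)"

section \<open>Causal models\<close>

text \<open>\<open>P X\<close> is the distribution of the observed nodes in the graph with intervention on \<open>X\<close>, and
  \<open>K X x\<close> is its conditional distribution given \<open>X = x\<close>, specified for all values \<open>x\<close>.

  In \<open>consistency\<close>, conditioning \<open>P Y\<close> on \<open>Y = y\<close> is conditioning on intervened nodes, hence is
  available for all \<open>y\<close>, while the further conditioning on the non-intervened nodes \<open>X\<close> is the
  usual one.  So the condition says that, for all \<open>y\<close>, the distributions \<open>K (X \<union> Y)\<close> are a version
  of the conditional distribution of \<open>K Y y\<close> given the nodes in \<open>X \<union> Y\<close>; this determines the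
  remaining nodes since the values of \<open>X \<union> Y\<close> are fixed on both sides.\<close>

locale causal_model = causal_structure V E Obs
  for V :: "'v set" and E :: "'v rel" and Obs :: "'v set" +
  fixes M :: "'v \<Rightarrow> 'a measure"
    and P :: "'v set \<Rightarrow> ('v \<Rightarrow> 'a) measure"
    and K :: "'v set \<Rightarrow> ('v \<Rightarrow> 'a) \<Rightarrow> ('v \<Rightarrow> 'a) measure"
  assumes distribution: "X \<subseteq> Obs \<Longrightarrow> P X \<in> space (prob_algebra (PiM Obs M))"
    and conditional: "X \<subseteq> Obs \<Longrightarrow> cond_distribution Obs M (P X) X (K X)"
    and d_separation_property:
      "\<lbrakk>X \<subseteq> Obs; A \<subseteq> Obs; B \<subseteq> Obs; C \<subseteq> Obs; A \<inter> B = {}; A \<inter> C = {}; B \<inter> C = {};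
        d_separated (do_graph E X) A B C\<rbrakk> \<Longrightarrow> cond_indep M (P X) A B C"
    and consistency:
      "\<lbrakk>X \<subseteq> Obs; Y \<subseteq> Obs; X \<inter> Y = {}; \<forall>v \<in> X. exogenous E v; y \<in> space (PiM Y M)\<rbrakk>
        \<Longrightarrow> cond_distribution Obs M (K Y y) (X \<union> Y) (K (X \<union> Y))"

text \<open>The third rule of do-calculus.  It does not follow from the conditions of the locale above,
  whose consistency condition only concerns nodes which are exogenous in the original graph.  The joint value of \<open>X \<union> Z\<close> with \<open>X = x\<close> and \<open>Z = z\<close> is
  \<open>merge X Z (x, z)\<close>.\<close>

definition do_calculus_rule3 ::
  "'v rel \<Rightarrow> 'v set \<Rightarrow> ('v \<Rightarrow> 'a measure)
    \<Rightarrow> ('v set \<Rightarrow> ('v \<Rightarrow> 'a) \<Rightarrow> ('v \<Rightarrow> 'a) measure) \<Rightarrow> bool" where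
  "do_calculus_rule3 E Obs M K \<longleftrightarrow>
     (\<forall>X Y Z. X \<subseteq> Obs \<and> Y \<subseteq> Obs \<and> Z \<subseteq> Obs \<and> X \<inter> Y = {} \<and> X \<inter> Z = {} \<and> Y \<inter> Z = {} \<and>
        d_separated (do_graph E (X \<union> Z)) Y Z X \<longrightarrow>
        (\<forall>x \<in> space (PiM X M). \<forall>z \<in> space (PiM Z M).
           cond_marginal M (K (X \<union> Z)) Y (merge X Z (x, z)) = cond_marginal M (K X) Y x))"

text \<open>\<open>affects M K X Y Z\<close> is the affects relation of \<open>X\<close> to \<open>Y\<close> given \<open>do(Z)\<close>.\<close>

definition affects ::
  "('v \<Rightarrow> 'a measure) \<Rightarrow> ('v set \<Rightarrow> ('v \<Rightarrow> 'a) \<Rightarrow> ('v \<Rightarrow> 'a) measure)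
    \<Rightarrow> 'v set \<Rightarrow> 'v set \<Rightarrow> 'v set \<Rightarrow> bool" where
  "affects M K X Y Z \<longleftrightarrow>
     (\<exists>x \<in> space (PiM X M). \<exists>z \<in> space (PiM Z M).
        cond_marginal M (K (X \<union> Z)) Y (merge X Z (x, z)) \<noteq> cond_marginal M (K Z) Y z)"

definition clus1 ::
  "('v \<Rightarrow> 'a measure) \<Rightarrow> ('v set \<Rightarrow> ('v \<Rightarrow> 'a) \<Rightarrow> ('v \<Rightarrow> 'a) measure)
    \<Rightarrow> 'v set \<Rightarrow> 'v set \<Rightarrow> 'v set \<Rightarrow> bool" where
  "clus1 M K X Y Z \<longleftrightarrow>
     card X \<ge> 2 \<and> \<not> (\<exists>S. S \<noteq> {} \<and> S \<subset> X \<and> affects M K S Y Z)"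

end

theory Submission
  imports Defs
begin

text \<open>Suppose \<open>e \<in> X\<close> is not a cause of any element of \<open>Y\<close>, and let \<open>S = X - {e}\<close>, which is
  non-empty.  In the graph with intervention on \<open>X \<union> Z\<close>, no edge enters \<open>e\<close>, so a path from \<open>Y\<close>
  to \<open>e\<close> is either directed from \<open>e\<close> to \<open>Y\<close>, which is excluded, or contains a collider.  Neither a
  collider nor its descendants are intervened nodes, so \<open>S \<union> Z\<close> blocks the path.  The third rule
  of do-calculus now removes the intervention on \<open>e\<close>, so \<open>S\<close> has the same effect on \<open>Y\<close> as \<open>X\<close>,
  contradicting clustering.\<close>

text \<open>For a path from \<open>A\<close> to \<open>e\<close> that never uses a forward edge,
  this makes \<open>e\<close> a cause of an element of \<open>A\<close>, the case excluded by
  assumption below.\<close>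

lemma backward_path_trancl:
  assumes path: "is_path E p d" and backward: "\<forall>i < length d. d ! i = Backward" and "d \<noteq> []"
  shows "(last p, hd p) \<in> E\<^sup>+"
proof -
  have len: "length p = Suc (length d)"
    using path by (simp add: is_path_def)
  have edge: "(p ! Suc i, p ! i) \<in> E" if "i < length d" for i
    using path backward that unfolding is_path_def by force
  have "(p ! Suc i, p ! 0) \<in> E\<^sup>+" if "i < length d" for i
    using that
  proof (induction i)
    case 0
    then show ?case using edge by blast
  next
    case (Suc i)
    then show ?case using edge[of "Suc i"] by (meson Suc_lessD trancl_into_trancl2)
  qed
  from this[of "length d - 1"] show ?thesis
    using \<open>d \<noteq> []\<close> len by (simp add: last_conv_nth hd_conv_nth flip: length_greater_0_conv)
qed

text \<open>The last \<open>Forward\<close> entry is not the final one, so a \<open>Backward\<close>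
  entry follows it. Since \<open>collider_at d i\<close> compares the entries \<open>i - 1\<close>
  and \<open>i\<close>, the collider sits one index after that entry.\<close>

lemma ex_collider_at:
  assumes "i < length d" "d ! i = Forward" "last d = Backward"
  obtains j where "0 < j" "j < length d" "collider_at d j"
proof -
  obtain k where k: "k < length d" "d ! k = Forward"
    and max: "\<And>l. l < length d \<Longrightarrow> d ! l = Forward \<Longrightarrow> l \<le> k"
    using Nat.ex_has_greatest_nat[of "\<lambda>k. k < length d \<and> d ! k = Forward" i "length d"] assms(1,2)
    by auto
  have "k \<noteq> length d - 1"
    using k assms(3) by (cases "d = []") (auto simp: last_conv_nth)
  then have "Suc k < length d"
    using k by linarith
  moreover have "d ! Suc k = Backward"
    using max[of "Suc k"] \<open>Suc k < length d\<close> by (cases "d ! Suc k") auto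
  ultimately show thesis
    using that[of "Suc k"] k by (simp add: collider_at_def)
qed

lemma trancl_do_graph_notin:
  assumes "(u, v) \<in> (do_graph E D)\<^sup>+"
  shows "v \<notin> D"
  using assms by cases (auto simp: do_graph_def)

lemma d_separated_do_graph_non_cause:
  assumes "e \<in> D" "C \<subseteq> D" "e \<notin> A" and non_cause: "\<forall>a \<in> A. (e, a) \<notin> E\<^sup>+"
  shows "d_separated (do_graph E D) A {e} C"
  unfolding d_separated_def
proof (intro allI impI)
  let ?G = "do_graph E D"
  fix p d
  assume "is_path ?G p d \<and> hd p \<in> A \<and> last p \<in> {e}"
  then have path: "is_path ?G p d" and hd: "hd p \<in> A" and last: "last p = e"
    by auto
  have len: "length p = Suc (length d)"
    using path by (simp add: is_path_def)
  have forward: "(p ! i, p ! Suc i) \<in> ?G" if "i < length d" "d ! i = Forward" for i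
    using path that unfolding is_path_def by force
  \<comment> \<open>A path with a single node would put \<open>e\<close> into
    \<open>A\<close>.\<close>
  have "d \<noteq> []"
    using len hd last \<open>e \<notin> A\<close> by (cases p) auto
  have "p ! length d = e"
    using len last by (subst (asm) last_conv_nth) auto
  \<comment> \<open>A final forward edge would enter \<open>e\<close>, but edges into
    \<open>D\<close> are removed.\<close>
  then have "d ! (length d - 1) \<noteq> Forward"
    using forward[of "length d - 1"] \<open>d \<noteq> []\<close> \<open>e \<in> D\<close> by (auto simp: do_graph_def)
  then have "last d = Backward"
    using \<open>d \<noteq> []\<close> by (metis direction.exhaust last_conv_nth)
  have "?G\<^sup>+ \<subseteq> E\<^sup>+"
    by (rule trancl_mono_subset) (auto simp: do_graph_def)
  then have "\<not> (\<forall>i < length d. d ! i = Backward)"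
    using backward_path_trancl[OF path _ \<open>d \<noteq> []\<close>] hd last non_cause by blast
  then obtain i where "i < length d" "d ! i = Forward"
    by (metis direction.exhaust)
  then obtain j where j: "0 < j" "j < length d" "collider_at d j"
    using \<open>last d = Backward\<close> by (rule ex_collider_at)
  \<comment> \<open>A collider is entered by an edge of \<open>?G\<close>, so it lies outside
    \<open>D\<close> and hence outside \<open>C\<close>. The same holds for its descendants.\<close>
  then have "(p ! (j - 1), p ! j) \<in> ?G"
    using forward[of "j - 1"] by (simp add: collider_at_def)
  then have "p ! j \<notin> C"
    using \<open>C \<subseteq> D\<close> by (auto simp: do_graph_def)
  moreover have "w \<notin> C" if "(p ! j, w) \<in> ?G\<^sup>+" for w
    using trancl_do_graph_notin[OF that] \<open>C \<subseteq> D\<close> by blast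
  ultimately show "path_blocked ?G p d C"
    unfolding path_blocked_def using j by blast
qed

theorem corollary4p16:
  fixes V :: "'v set" and E :: "'v rel" and Obs :: "'v set"
    and M :: "'v \<Rightarrow> 'a measure"
    and P :: "'v set \<Rightarrow> ('v \<Rightarrow> 'a) measure"
    and K :: "'v set \<Rightarrow> ('v \<Rightarrow> 'a) \<Rightarrow> ('v \<Rightarrow> 'a) measure"
    and X Y Z :: "'v set"
  assumes "causal_model V E Obs M P K"
    and "do_calculus_rule3 E Obs M K"
    and "X \<subseteq> Obs" and "Y \<subseteq> Obs" and "Z \<subseteq> Obs"
    and "X \<inter> Y = {}" and "X \<inter> Z = {}" and "Y \<inter> Z = {}"
    and "X \<noteq> {}" and "Y \<noteq> {}"
    and "affects M K X Y Z"
    and "clus1 M K X Y Z"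
  shows "\<forall>eX \<in> X. \<exists>eY \<in> Y. (eX, eY) \<in> E\<^sup>+"
proof (intro ballI, rule ccontr)
  fix e
  assume "e \<in> X" and "\<not> (\<exists>eY \<in> Y. (e, eY) \<in> E\<^sup>+)"
  define S where "S = X - {e}"
  have X: "X \<union> Z = (S \<union> Z) \<union> {e}"
    using \<open>e \<in> X\<close> by (auto simp: S_def)
  have "S \<noteq> {}"
  proof
    assume "S = {}"
    then have "card X \<le> card {e}"
      by (intro card_mono) (auto simp: S_def)
    then show False
      using \<open>clus1 M K X Y Z\<close> by (simp add: clus1_def)
  qed
  then have not_affects: "\<not> affects M K S Y Z"
    using \<open>clus1 M K X Y Z\<close> \<open>e \<in> X\<close> by (auto simp: clus1_def S_def)
  have "d_separated (do_graph E (S \<union> Z \<union> {e})) Y {e} (S \<union> Z)"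
    using \<open>\<not> (\<exists>eY \<in> Y. (e, eY) \<in> E\<^sup>+)\<close> \<open>e \<in> X\<close> \<open>X \<inter> Y = {}\<close>
    by (intro d_separated_do_graph_non_cause) auto
  moreover have "S \<union> Z \<subseteq> Obs" "{e} \<subseteq> Obs" "(S \<union> Z) \<inter> Y = {}" "(S \<union> Z) \<inter> {e} = {}" "Y \<inter> {e} = {}"
    using assms(3-8) \<open>e \<in> X\<close> by (auto simp: S_def)
  \<comment> \<open>The rule is applied with \<open>S \<union> Z\<close> as the retained
    intervention and \<open>{e}\<close> as the dropped one.\<close>
  ultimately have rule3: "cond_marginal M (K (S \<union> Z \<union> {e})) Y (merge (S \<union> Z) {e} (w, u))
      = cond_marginal M (K (S \<union> Z)) Y w"
    if "w \<in> space (PiM (S \<union> Z) M)" "u \<in> space (PiM {e} M)" for w u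
    using \<open>do_calculus_rule3 E Obs M K\<close>[unfolded do_calculus_rule3_def, rule_format,
        of "S \<union> Z" Y "{e}" w u] \<open>Y \<subseteq> Obs\<close> that
    by simp
  have "cond_marginal M (K (X \<union> Z)) Y (merge X Z (x, z)) = cond_marginal M (K Z) Y z"
    if x: "x \<in> space (PiM X M)" and z: "z \<in> space (PiM Z M)" for x z
  proof -
    let ?w = "merge S Z (restrict x S, z)"
    have xS: "restrict x S \<in> space (PiM S M)"
      using x by (auto simp: space_PiM S_def)
    have xe: "restrict x {e} \<in> space (PiM {e} M)"
      using x \<open>e \<in> X\<close> by (auto simp: space_PiM)
    have w: "?w \<in> space (PiM (S \<union> Z) M)"
      using xS z by (auto simp: space_PiM PiE_iff merge_def extensional_def)
    \<comment> \<open>As \<open>merge\<close> prefers its first component, the two sides agree at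
      \<open>e\<close> only because \<open>e\<close> is not in \<open>Z\<close>.\<close>
    have "merge X Z (x, z) = merge (S \<union> Z) {e} (?w, restrict x {e})"
      using \<open>e \<in> X\<close> \<open>X \<inter> Z = {}\<close> by (auto simp: merge_def S_def fun_eq_iff)
    then have "cond_marginal M (K (X \<union> Z)) Y (merge X Z (x, z)) = cond_marginal M (K (S \<union> Z)) Y ?w"
      using rule3[OF w xe] by (simp only: X)
    also have "\<dots> = cond_marginal M (K Z) Y z"
      using not_affects xS z unfolding affects_def by blast
    finally show ?thesis .
  qed
  then show False
    using \<open>affects M K X Y Z\<close> unfolding affects_def by blast
qed

end
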